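(* Let $X_1,X_2,\ldots$ be random variables (not assumed independent or identically distributed), defined on a common probability space, for which there exists a constant $a\in(0,\infty)$ such that $$\frac1n\sum_{j=1}^n X_j\Longrightarrow a\qquad (n\to\infty).$$ Put $S_k=X_1+\ldots+X_k$ for $k\in\mathbb{N}$ and $S_0=0$. Let $r>0$, $q\in(0,1)$ and $\mu>0$ be arbitrary. For each $n\in\mathbb{N}$, let the random variable $N_{r,p_n}$ have the negative binomial distribution with parameters $r$ and $p_n=\min\{q,\mu/n\}$, and assume that the random variables $N_{r,p_n}$ are independent of the sequence $X_1,X_2,\ldots$. Then $$n^{-1}S_{N_{r,p_n}}\Longrightarrow a\,G_{r,\mu}\stackrel{d}{=}\frac{a}{\mu}\,G_{r,1}$$ as $n\to\infty$.
   Context: The symbol $\Longrightarrow$ denotes convergence in distribution and $\stackrel{d}{=}$ denotes equality in distribution. For $r>0$, $\lambda>0$, $G_{r,\lambda}$ denotes a random variable having the gamma distribution with shape parameter $r$ and (rate-type) scale parameter $\lambda$, that is, $\mathbb{P}(G_{r,\lambda}<x)=\int_0^x\frac{\lambda^r}{\Gamma(r)}z^{r-1}e^{-\lambda z}\,dz$ for $x\ge 0$. A random variable $N_{r,p}$ has the negative binomial distribution with parameters $r>0$ and $p\in(0,1)$ if $\mathbb{P}(N_{r,p}=k)=\frac{\Gamma(r+k)}{k!\,\Gamma(r)}p^r(1-p)^k$ for $k=0,1,2,\ldots$. In the paper's application, $X_1,X_2,\ldots$ are the daily precipitation volumes on wet days. *)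

theory Defs
  imports "HOL-Probability.Probability"
begin

text \<open>
  The density of the gamma distribution with real shape \<open>r\<close> and rate \<open>l\<close>; the library's
  \<^term>\<open>erlang_density\<close> covers integer shapes only (and is offset by one in its shape argument).
\<close>

definition gamma_density :: "real \<Rightarrow> real \<Rightarrow> real \<Rightarrow> real" where
  "gamma_density r l z =
     (if z \<le> 0 then 0 else l powr r / Gamma r * z powr (r - 1) * exp (- l * z))"

text \<open>
  The library's \<^term>\<open>neg_binomial_pmf\<close> requires a natural number as its first parameter; here
  it is real.
\<close>

definition neg_binomial_mass :: "real \<Rightarrow> real \<Rightarrow> nat \<Rightarrow> real" where
  "neg_binomial_mass r p k =
     Gamma (r + real k) / (fact k * Gamma r) * p powr r * (1 - p) ^ k"

text \<open>
  The library's \<^term>\<open>prob_space.indep_var\<close> forces both random variables to take values in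
  the same type. This is the same notion for two different types of values.
\<close>

definition indep_rv ::
  "'a measure \<Rightarrow> 'b measure \<Rightarrow> ('a \<Rightarrow> 'b) \<Rightarrow> 'c measure \<Rightarrow> ('a \<Rightarrow> 'c) \<Rightarrow> bool" where
  "indep_rv M A X B Y \<longleftrightarrow>
     X \<in> M \<rightarrow>\<^sub>M A \<and> Y \<in> M \<rightarrow>\<^sub>M B \<and>
     prob_space.indep_set M {X -` S \<inter> space M | S. S \<in> sets A} {Y -` T \<inter> space M | T. T \<in> sets B}"

lemma (in prob_space) indep_rv_iff_indep_var: "indep_rv M A X B Y \<longleftrightarrow> indep_var A X B Y"
proof -
  have "(\<lambda>i. {case_bool X Y i -` S \<inter> space M | S. S \<in> sets (case_bool A B i)}) =
      case_bool {X -` S \<inter> space M | S. S \<in> sets A} {Y -` T \<inter> space M | T. T \<in> sets B}"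
    by (rule ext) (simp split: bool.split)
  then show ?thesis
    by (simp add: indep_rv_def indep_var_def indep_vars_def2 indep_set_def UNIV_bool ex_bool_eq conj_ac)
qed

lemma borel_measurable_gamma_density [measurable]: "gamma_density r l \<in> borel_measurable borel"
  unfolding gamma_density_def [abs_def] by measurable

lemma gamma_density_nonneg: "0 < r \<Longrightarrow> 0 < l \<Longrightarrow> 0 \<le> gamma_density r l z"
  by (simp add: gamma_density_def Gamma_real_pos less_imp_le)

lemma gamma_density_eq_erlang_density:
  assumes "x > 0" "l > 0"
  shows "gamma_density (real (Suc k)) l x = erlang_density k l x"
proof -
  have "Gamma (real (Suc k)) = fact k"
    using Gamma_fact[of k, where 'a=real] by (simp add: add.commute)
  then show ?thesis
    using assms powr_realpow[of l "Suc k"] powr_realpow[of x k]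
    by (simp add: gamma_density_def erlang_density_def add.commute)
qed

lemma prob_space_gamma_density:
  assumes r: "0 < r" and l: "0 < l"
  shows "prob_space (density lborel (gamma_density r l))"
proof
  have G: "0 < Gamma r" using r by (rule Gamma_real_pos)
  have eq: "ennreal (indicator {0..} (0 + l * t) * (0 + l * t) powr (r - 1) / exp (0 + l * t))
      = ennreal (Gamma r / l) * ennreal (gamma_density r l t)" for t
  proof (cases "t > 0")
    case True
    then have "indicator {0..} (0 + l * t) * (0 + l * t) powr (r - 1) / exp (0 + l * t)
        = Gamma r / l * gamma_density r l t"
      using l G by (simp add: gamma_density_def powr_mult powr_diff exp_minus field_simps)
    then show ?thesis
      using l G by (simp add: ennreal_mult' [symmetric])
  next
    case False
    then show ?thesis
      using l by (cases "t = 0") (auto simp: gamma_density_def indicator_def mult_less_0_iff zero_le_mult_iff)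
  qed
  have "ennreal (Gamma r) = (\<integral>\<^sup>+t. ennreal (indicator {0..} t * t powr (r - 1) / exp t) \<partial>lborel)"
    using r by (rule Gamma_conv_nn_integral_real)
  also have "\<dots> = ennreal \<bar>l\<bar> * (\<integral>\<^sup>+t. ennreal (indicator {0..} (0 + l * t) *
      (0 + l * t) powr (r - 1) / exp (0 + l * t)) \<partial>lborel)"
    using l by (intro nn_integral_real_affine) auto
  also have "\<dots> = ennreal l * (ennreal (Gamma r / l) * (\<integral>\<^sup>+t. gamma_density r l t \<partial>lborel))"
    unfolding eq using l by (subst nn_integral_cmult) auto
  also have "\<dots> = ennreal (Gamma r) * (\<integral>\<^sup>+t. gamma_density r l t \<partial>lborel)"
    using l G by (simp add: mult.assoc [symmetric] ennreal_mult' [symmetric])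
  finally have "ennreal (Gamma r) * 1 = ennreal (Gamma r) * (\<integral>\<^sup>+t. gamma_density r l t \<partial>lborel)"
    by simp
  then have "(\<integral>\<^sup>+t. gamma_density r l t \<partial>lborel) = 1"
    using G by (subst (asm) ennreal_mult_cancel_left) auto
  then show "emeasure (density lborel (gamma_density r l)) (space (density lborel (gamma_density r l))) = 1"
    by (simp add: emeasure_density)
qed

lemma neg_binomial_mass_gbinomial:
  assumes "0 < r"
  shows "neg_binomial_mass r p k = p powr r * ((- r gchoose k) * (- (1 - p)) ^ k)"
proof -
  have "r \<notin> \<int>\<^sub>\<le>\<^sub>0" using assms by (auto elim!: nonpos_Ints_cases)
  then have "pochhammer r k = Gamma (r + real k) / Gamma r"
    by (rule pochhammer_Gamma)
  moreover have "(- 1) ^ k * (- (1 - p)) ^ k = (1 - p) ^ k"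
    by (simp flip: power_mult_distrib)
  ultimately show ?thesis
    by (simp add: neg_binomial_mass_def gbinomial_pochhammer mult_ac)
qed

lemma neg_binomial_mass_sums_1:
  assumes "0 < r" "0 < p" "p < 1"
  shows "neg_binomial_mass r p sums 1"
proof -
  have "(\<lambda>k. (- r gchoose k) * (- (1 - p)) ^ k) sums (1 + - (1 - p)) powr (- r)"
    using assms by (intro gen_binomial_real) auto
  then have "(\<lambda>k. p powr r * ((- r gchoose k) * (- (1 - p)) ^ k)) sums (p powr r * p powr (- r))"
    by (intro sums_mult) simp
  moreover have "neg_binomial_mass r p = (\<lambda>k. p powr r * ((- r gchoose k) * (- (1 - p)) ^ k))"
    using assms by (auto simp: neg_binomial_mass_gbinomial)
  ultimately show ?thesis
    using assms by (simp add: powr_add [symmetric])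
qed

end

theory Submission
  imports Defs "HOL-Real_Asymp.Real_Asymp"
begin

text \<open>
  Write \<open>m n k\<close> for the mass of \<open>N n\<close> at \<open>k\<close>. By independence, the distribution function of
  \<open>S\<^bsub>N n\<^esub> / n\<close> at \<open>y\<close> is \<open>\<Sum>k. m n k * P(S\<^sub>k \<le> y * n)\<close>, which is the integral over \<open>x \<ge> 0\<close> of
  \<open>n * m n \<lfloor>n * x\<rfloor> * P(S\<^bsub>\<lfloor>n * x\<rfloor>\<^esub> \<le> y * n)\<close>. The first factor \<open>n * m n \<lfloor>n * x\<rfloor>\<close> is a probability
  density that converges pointwise to the gamma density, hence in \<open>L\<^sup>1\<close> by Scheffe's lemma; the
  probability converges to the indicator of \<open>a * x \<le> y\<close> by the weak law assumed for \<open>S\<^sub>k / k\<close>.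
\<close>

section \<open>Series as integrals of step functions, and the limit of mixtures\<close>

text \<open>The half-line splits into cells \<open>[k/c, (k+1)/c)\<close> of length
  \<open>1/c\<close>, and the integrand is constantly \<open>c * u k\<close> on the
  \<open>k\<close>-th cell, which therefore contributes exactly \<open>u k\<close>. Sums over
  \<open>k\<close> at different scales \<open>c\<close> thus become integrals over one fixed measure
  space.\<close>

lemma has_bochner_integral_floor:
  fixes u :: "nat \<Rightarrow> real"
  assumes c: "c > 0" and u: "\<And>k. 0 \<le> u k" "u sums s"
  shows "has_bochner_integral lborel (\<lambda>x. indicator {0..} x * (c * u (nat \<lfloor>c * x\<rfloor>))) s"
proof (rule has_bochner_integral_nn_integral)
  have [measurable]: "u \<in> borel_measurable (count_space UNIV)" by simp
  show "(\<lambda>x. indicator {0..} x * (c * u (nat \<lfloor>c * x\<rfloor>))) \<in> borel_measurable lborel"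
    by measurable
  show "AE x in lborel. 0 \<le> indicator {0..} x * (c * u (nat \<lfloor>c * x\<rfloor>))"
    using c u by (auto simp: indicator_def)
  show "0 \<le> s"
    using u sums_le[OF _ sums_zero u(2)] by auto
  \<comment> \<open>For \<open>x >= 0\<close> only the cell with index \<open>j\<close> contains
    \<open>x\<close>, so the series has a single nonzero term; for \<open>x < 0\<close> no cell
    contains \<open>x\<close>.\<close>
  have eq: "ennreal (indicator {0..} x * (c * u (nat \<lfloor>c * x\<rfloor>)))
      = (\<Sum>k. ennreal (c * u k) * indicator {real k / c..<(real k + 1) / c} x)" for x :: real
  proof (cases "x \<ge> 0")
    case True
    define j where "j = nat \<lfloor>c * x\<rfloor>"
    have mem: "x \<in> {real k / c..<(real k + 1) / c} \<longleftrightarrow> k = j" for k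
    proof -
      have "x \<in> {real k / c..<(real k + 1) / c} \<longleftrightarrow> real k \<le> c * x \<and> c * x < real k + 1"
        using c by (simp add: field_simps)
      also have "\<dots> \<longleftrightarrow> \<lfloor>c * x\<rfloor> = int k"
        by (simp add: floor_eq_iff)
      also have "\<dots> \<longleftrightarrow> k = j"
        using True c by (auto simp: j_def)
      finally show ?thesis .
    qed
    have "(\<Sum>k. ennreal (c * u k) * indicator {real k / c..<(real k + 1) / c} x)
        = (\<Sum>k\<in>{j}. ennreal (c * u k) * indicator {real k / c..<(real k + 1) / c} x)"
      by (rule suminf_finite) (use mem in \<open>auto simp: indicator_def\<close>)
    also have "\<dots> = ennreal (c * u j)"
      using mem[of j] by (simp add: indicator_def)
    finally show ?thesis
      using True by (simp add: j_def)
  next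
    case False
    then have "indicator {real k / c..<(real k + 1) / c} x = (0 :: ennreal)" for k
      using c False order.trans[of 0 "real k / c" x] by (auto simp: indicator_def)
    then show ?thesis
      using False by simp
  qed
  have "(\<integral>\<^sup>+x. ennreal (indicator {0..} x * (c * u (nat \<lfloor>c * x\<rfloor>))) \<partial>lborel)
      = (\<Sum>k. \<integral>\<^sup>+x. ennreal (c * u k) * indicator {real k / c..<(real k + 1) / c} x \<partial>lborel)"
    unfolding eq by (rule nn_integral_suminf) simp
  also have "\<dots> = (\<Sum>k. ennreal (u k))"
  proof (rule suminf_cong)
    fix k
    have "(real k + 1) / c - real k / c = 1 / c"
      by (simp add: diff_divide_distrib [symmetric])
    then show "(\<integral>\<^sup>+x. ennreal (c * u k) * indicator {real k / c..<(real k + 1) / c} x \<partial>lborel)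
        = ennreal (u k)"
      using c u(1)[of k]
      by (simp add: nn_integral_cmult divide_right_mono ennreal_mult' [symmetric] field_simps)
  qed
  also have "\<dots> = ennreal s"
    using u sums_unique[OF u(2)] by (simp add: suminf_ennreal2 sums_summable)
  finally show "(\<integral>\<^sup>+x. ennreal (indicator {0..} x * (c * u (nat \<lfloor>c * x\<rfloor>))) \<partial>lborel) = ennreal s" .
qed

text \<open>The two factors converge in different senses. The rescaled weights are probability
  densities converging almost everywhere to a probability density, hence in L1; the factors
  \<open>g\<close> are only bounded by 1 and converge almost everywhere. Boundedness lets the
  weights be replaced by \<open>f\<close> first, and dominated convergence then treats
  \<open>g\<close>.\<close>

lemma mixture_limit:
  fixes m g :: "nat \<Rightarrow> nat \<Rightarrow> real" and f h :: "real \<Rightarrow> real"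
  assumes m: "\<And>n k. n \<ge> 1 \<Longrightarrow> 0 \<le> m n k" "\<And>n. n \<ge> 1 \<Longrightarrow> m n sums 1"
    and g: "\<And>n k. 0 \<le> g n k" "\<And>n k. g n k \<le> 1"
    and f: "f \<in> borel_measurable borel" "\<And>x. 0 \<le> f x" "\<And>x. x < 0 \<Longrightarrow> f x = 0"
      "prob_space (density lborel f)"
    and h[measurable]: "h \<in> borel_measurable borel"
    and m_lim: "AE x in lborel. 0 < x \<longrightarrow> (\<lambda>n. real n * m n (nat \<lfloor>real n * x\<rfloor>)) \<longlonglongrightarrow> f x"
    and g_lim: "AE x in lborel. 0 < x \<longrightarrow> (\<lambda>n. g n (nat \<lfloor>real n * x\<rfloor>)) \<longlonglongrightarrow> h x"
  shows "(\<lambda>n. \<Sum>k. m n k * g n k) \<longlonglongrightarrow> (\<integral>x. f x * h x \<partial>lborel)"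
proof -
  define F where "F = (\<lambda>n x. indicator {0..} x * (real n * m n (nat \<lfloor>real n * x\<rfloor>)))"
  define G where "G = (\<lambda>n x. g n (nat \<lfloor>real n * x\<rfloor>))"
  note f(1)[measurable]
  have [measurable]: "m n \<in> borel_measurable (count_space UNIV)"
    "g n \<in> borel_measurable (count_space UNIV)" for n by simp_all
  have [measurable]: "F n \<in> borel_measurable borel" "G n \<in> borel_measurable borel" for n
    by (simp_all add: F_def G_def)
  \<comment> \<open>The weights are controlled only for \<open>n >= 1\<close>; the factor
    \<open>real n\<close> makes index 0 harmless, so that integrability and the norm bound hold for
    every \<open>n\<close>.\<close>
  have F0: "F 0 = (\<lambda>x. 0)" by (simp add: F_def)
  have F_nonneg: "0 \<le> F n x" for n x
    using m(1)[of n] by (cases "n = 0") (auto simp: F_def)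
  have hbF: "has_bochner_integral lborel (F n) 1" if "n \<ge> 1" for n
    unfolding F_def using that m by (intro has_bochner_integral_floor) auto
  have Fint: "integrable lborel (F n)" for n
    using hbF[of n] by (cases "n = 0") (auto simp: F0 has_bochner_integral_iff)
  have fnn: "(\<integral>\<^sup>+x. ennreal (f x) \<partial>lborel) = 1"
    using prob_space.emeasure_space_1[OF f(4)] by (simp add: emeasure_density)
  have fint: "integrable lborel f"
    by (rule integrableI_nonneg) (use fnn f in auto)
  have Gb: "0 \<le> G n x" "G n x \<le> 1" for n x
    using g by (auto simp: G_def)
  \<comment> \<open>For \<open>x < 0\<close> both sides vanish, and the remaining point 0 is a null
    set.\<close>
  have "AE x in lborel. (\<lambda>n. F n x) \<longlonglongrightarrow> f x"
    using m_lim AE_lborel_singleton[of 0]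
  proof eventually_elim
    case (elim x)
    then show ?case
      using f(3)[of x] by (cases "x > 0") (auto simp: F_def)
  qed
  \<comment> \<open>The norm condition of Scheffe's lemma: both integrals are 1 for
    \<open>n >= 1\<close>, and the left one is 0 for \<open>n = 0\<close>.\<close>
  moreover have "(\<integral>\<^sup>+x. ennreal (norm (F n x)) \<partial>lborel) \<le> (\<integral>\<^sup>+x. ennreal (norm (f x)) \<partial>lborel)" for n
  proof (cases "n = 0")
    case False
    then have "(\<integral>\<^sup>+x. ennreal (F n x) \<partial>lborel) = 1"
      using hbF[of n] F_nonneg by (subst nn_integral_eq_integral) (auto simp: has_bochner_integral_iff)
    then show ?thesis
      using F_nonneg f by (simp add: fnn)
  qed (simp add: F0)
  ultimately have "(\<lambda>n. \<integral>\<^sup>+x. ennreal (norm (F n x - f x)) \<partial>lborel) \<longlonglongrightarrow> 0"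
    using fint by (intro Scheffe_lemma2) auto
  then have "(\<lambda>n. ennreal (\<integral>x. norm (F n x - f x) \<partial>lborel)) \<longlonglongrightarrow> ennreal 0"
    using Fint fint by (subst (asm) nn_integral_eq_integral) auto
  then have L1: "(\<lambda>n. \<integral>x. norm (F n x - f x) \<partial>lborel) \<longlonglongrightarrow> 0"
    by (subst (asm) tendsto_ennreal_iff) auto
  have FG: "integrable lborel (\<lambda>x. F n x * G n x)" for n
    using Gb[of n] F_nonneg[of n]
    by (intro Bochner_Integration.integrable_bound[OF Fint[of n]]) (auto simp: abs_mult mult_left_le)
  have fG: "integrable lborel (\<lambda>x. f x * G n x)" for n
    using Gb[of n] f(2)
    by (intro Bochner_Integration.integrable_bound[OF fint]) (auto simp: abs_mult mult_left_le)
  \<comment> \<open>Since \<open>G n\<close> takes values in the unit interval, replacing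
    \<open>F n\<close> by \<open>f\<close> costs at most their L1 distance.\<close>
  have "(\<lambda>n. (\<integral>x. F n x * G n x \<partial>lborel) - (\<integral>x. f x * G n x \<partial>lborel)) \<longlonglongrightarrow> 0"
  proof (rule Lim_null_comparison[OF always_eventually L1], rule allI)
    fix n
    have "norm ((\<integral>x. F n x * G n x \<partial>lborel) - (\<integral>x. f x * G n x \<partial>lborel))
        = norm (\<integral>x. (F n x - f x) * G n x \<partial>lborel)"
      using FG fG by (simp add: left_diff_distrib)
    also have "\<dots> \<le> (\<integral>x. norm ((F n x - f x) * G n x) \<partial>lborel)"
      by (rule integral_norm_bound)
    also have "\<dots> \<le> (\<integral>x. norm (F n x - f x) \<partial>lborel)"
    proof (rule integral_mono)
      show "integrable lborel (\<lambda>x. norm ((F n x - f x) * G n x))"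
        using FG[of n] fG[of n] by (simp add: left_diff_distrib)
      show "integrable lborel (\<lambda>x. norm (F n x - f x))"
        using Fint fint by simp
      show "norm ((F n x - f x) * G n x) \<le> norm (F n x - f x)" for x
        using Gb[of n x] by (simp add: abs_mult mult_left_le)
    qed
    finally show "norm ((\<integral>x. F n x * G n x \<partial>lborel) - (\<integral>x. f x * G n x \<partial>lborel))
        \<le> (\<integral>x. norm (F n x - f x) \<partial>lborel)" .
  qed
  moreover have "(\<lambda>n. \<integral>x. f x * G n x \<partial>lborel) \<longlonglongrightarrow> (\<integral>x. f x * h x \<partial>lborel)"
  proof (rule integral_dominated_convergence[where w = f])
    show "AE x in lborel. (\<lambda>n. f x * G n x) \<longlonglongrightarrow> f x * h x"
      using g_lim AE_lborel_singleton[of 0]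
    proof eventually_elim
      case (elim x)
      then show ?case
        using f(3)[of x] by (cases "x > 0") (auto simp: G_def intro!: tendsto_mult_left)
    qed
    show "AE x in lborel. norm (f x * G n x) \<le> f x" for n
      using Gb[of n] f(2) by (auto simp: abs_mult mult_left_le)
  qed (use fint in auto)
  ultimately have "(\<lambda>n. ((\<integral>x. F n x * G n x \<partial>lborel) - (\<integral>x. f x * G n x \<partial>lborel))
      + (\<integral>x. f x * G n x \<partial>lborel)) \<longlonglongrightarrow> 0 + (\<integral>x. f x * h x \<partial>lborel)"
    by (rule tendsto_add)
  then have "(\<lambda>n. \<integral>x. F n x * G n x \<partial>lborel) \<longlonglongrightarrow> (\<integral>x. f x * h x \<partial>lborel)"
    by simp
  \<comment> \<open>Back from the integral to the series, by the cell decomposition with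
    \<open>c = n\<close> applied to the products \<open>m n k * g n k\<close>.\<close>
  moreover have "\<forall>\<^sub>F n in sequentially. (\<integral>x. F n x * G n x \<partial>lborel) = (\<Sum>k. m n k * g n k)"
    using eventually_ge_at_top[of 1]
  proof eventually_elim
    case (elim n)
    have "summable (\<lambda>k. m n k * g n k)"
      by (rule summable_comparison_test'[OF sums_summable[OF m(2)[OF elim]]])
        (use m(1)[OF elim] g in \<open>auto simp: abs_mult mult_left_le\<close>)
    then have "has_bochner_integral lborel (\<lambda>x. indicator {0..} x *
        (real n * (m n (nat \<lfloor>real n * x\<rfloor>) * g n (nat \<lfloor>real n * x\<rfloor>)))) (\<Sum>k. m n k * g n k)"
      using elim m(1) g by (intro has_bochner_integral_floor) (auto simp: summable_sums)
    then show ?case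
      by (simp add: F_def G_def has_bochner_integral_iff mult.assoc)
  qed
  ultimately show ?thesis
    by (rule Lim_transform_eventually)
qed

section \<open>Local limit of the negative binomial masses\<close>

text \<open>This comes from Euler's limit \<open>Gamma_series r k\<close> for
  \<open>Gamma r\<close>. Its denominator \<open>pochhammer r (k + 1)\<close> equals
  \<open>(r + k) * Gamma (r + k) / Gamma r\<close>, so the ratio is
  \<open>Gamma r / Gamma_series r k\<close> up to the factor \<open>k / (r + k)\<close>, which tends
  to 1.\<close>

lemma Gamma_ratio_tendsto_1:
  fixes r :: real
  assumes r: "r > 0"
  shows "(\<lambda>k. Gamma (r + real k) / (fact k * real k powr (r - 1))) \<longlonglongrightarrow> 1"
proof -
  have G: "0 < Gamma r" using r by (rule Gamma_real_pos)
  have nr: "r \<notin> \<int>\<^sub>\<le>\<^sub>0" using r by (auto elim!: nonpos_Ints_cases)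
  have "(\<lambda>k. Gamma r / Gamma_series r k) \<longlonglongrightarrow> Gamma r / Gamma r"
    using G by (intro tendsto_intros Gamma_series_LIMSEQ) auto
  moreover have "(\<lambda>k. real k / (r + real k)) \<longlonglongrightarrow> 1"
    by real_asymp
  ultimately have "(\<lambda>k. Gamma r / Gamma_series r k * (real k / (r + real k))) \<longlonglongrightarrow> Gamma r / Gamma r * 1"
    by (rule tendsto_mult)
  then have lim: "(\<lambda>k. Gamma r / Gamma_series r k * (real k / (r + real k))) \<longlonglongrightarrow> 1"
    using G by simp
  show ?thesis
  proof (rule Lim_transform_eventually[OF lim])
    show "\<forall>\<^sub>F k in sequentially. Gamma r / Gamma_series r k * (real k / (r + real k))
        = Gamma (r + real k) / (fact k * real k powr (r - 1))"
      using eventually_gt_at_top[of 0]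
    proof eventually_elim
      case (elim k)
      have "pochhammer r (k + 1) = (r + real k) * pochhammer r k"
        by (simp add: pochhammer_Suc mult.commute)
      also have "pochhammer r k = Gamma (r + real k) / Gamma r"
        using nr by (rule pochhammer_Gamma)
      finally have p: "pochhammer r (k + 1) = (r + real k) * (Gamma (r + real k) / Gamma r)" .
      have e: "exp (r * ln (real k)) = real k * real k powr (r - 1)"
        using elim by (simp add: powr_def ring_distribs exp_diff)
      \<comment> \<open>The required cancellation, with \<open>g0 = Gamma r\<close>,
        \<open>F = fact k\<close>, \<open>x = real k\<close>,
        \<open>w = real k powr (r - 1)\<close>, \<open>s = r + real k\<close> and
        \<open>g = Gamma (r + real k)\<close>.\<close>
      have "g0 / (F * (x * w) / (s * (g / g0))) * (x / s) = g / (F * w)"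
        if "g0 \<noteq> 0" "F \<noteq> 0" "x \<noteq> 0" "w \<noteq> 0" "s \<noteq> 0" for g0 F x w s g :: real
        using that by (simp add: field_simps)
      moreover have "r + real k \<noteq> 0" "real k powr (r - 1) \<noteq> 0" using r elim by auto
      ultimately show ?case
        using G elim unfolding Gamma_series_def p by (simp add: e)
    qed
  qed
qed

text \<open>Once \<open>p = \<mu> / n\<close>, the rescaled mass at \<open>k = k n\<close> is a
  constant times three factors with separate limits: the Gamma ratio above,
  \<open>(k / n) powr (r - 1)\<close>, and \<open>(1 - p) ^ k\<close>, written as the exponential of
  \<open>(k / n) * (n * ln (1 - \<mu> / n))\<close>. The limits use \<open>k / n\<close> tending to
  \<open>x\<close> and \<open>k\<close> tending to infinity.\<close>

lemma neg_binomial_local_limit: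
  assumes r: "r > 0" and q: "0 < q" "q < 1" and mu: "\<mu> > 0" and x: "x > 0"
  shows "(\<lambda>n. real n * neg_binomial_mass r (min q (\<mu> / real n)) (nat \<lfloor>real n * x\<rfloor>))
    \<longlonglongrightarrow> gamma_density r \<mu> x"
proof -
  define k where "k = (\<lambda>n::nat. nat \<lfloor>real n * x\<rfloor>)"
  have rk: "real (k n) = of_int \<lfloor>real n * x\<rfloor>" for n
    using x by (simp add: k_def)
  have kn: "(\<lambda>n. real (k n) / real n) \<longlonglongrightarrow> x"
    unfolding rk using x by real_asymp
  have ktop: "filterlim k at_top sequentially"
    unfolding k_def using x by real_asymp
  have A: "(\<lambda>n. Gamma (r + real (k n)) / (fact (k n) * real (k n) powr (r - 1))) \<longlonglongrightarrow> 1"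
    by (rule filterlim_compose[OF Gamma_ratio_tendsto_1[OF r] ktop])
  have B: "(\<lambda>n. (real (k n) / real n) powr (r - 1)) \<longlonglongrightarrow> x powr (r - 1)"
    using x by (intro tendsto_intros kn) auto
  have "(\<lambda>n. real n * ln (1 - \<mu> / real n)) \<longlonglongrightarrow> - \<mu>"
    using mu by real_asymp
  then have C: "(\<lambda>n. exp ((real (k n) / real n) * (real n * ln (1 - \<mu> / real n)))) \<longlonglongrightarrow> exp (x * - \<mu>)"
    by (intro tendsto_intros kn)
  have "(\<lambda>n. \<mu> powr r / Gamma r * (Gamma (r + real (k n)) / (fact (k n) * real (k n) powr (r - 1)))
        * (real (k n) / real n) powr (r - 1)
        * exp ((real (k n) / real n) * (real n * ln (1 - \<mu> / real n))))
      \<longlonglongrightarrow> \<mu> powr r / Gamma r * 1 * x powr (r - 1) * exp (x * - \<mu>)"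
    by (intro tendsto_mult[OF tendsto_mult[OF tendsto_mult[OF tendsto_const A] B] C])
  moreover have "\<mu> powr r / Gamma r * 1 * x powr (r - 1) * exp (x * - \<mu>) = gamma_density r \<mu> x"
    using x by (simp add: gamma_density_def mult.commute)
  moreover have "\<forall>\<^sub>F n in sequentially.
      \<mu> powr r / Gamma r * (Gamma (r + real (k n)) / (fact (k n) * real (k n) powr (r - 1)))
        * (real (k n) / real n) powr (r - 1)
        * exp ((real (k n) / real n) * (real n * ln (1 - \<mu> / real n)))
      = real n * neg_binomial_mass r (min q (\<mu> / real n)) (k n)"
  proof -
    \<comment> \<open>Because \<open>q > 0\<close>, the minimum is eventually
      \<open>\<mu> / n\<close>. Eventually also \<open>k n >= 1\<close>, so that the power of
      \<open>k n\<close> can be cancelled.\<close>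
    have "(\<lambda>n. \<mu> / real n) \<longlonglongrightarrow> 0" by real_asymp
    then have "\<forall>\<^sub>F n in sequentially. \<mu> / real n < q"
      using q by (intro order_tendstoD)
    moreover have "\<forall>\<^sub>F n in sequentially. 1 \<le> k n"
      using ktop by (simp add: filterlim_at_top)
    ultimately show ?thesis
      using eventually_gt_at_top[of 0]
    proof eventually_elim
      case (elim n)
      have "\<mu> / real n < 1" using elim q by linarith
      then have e: "exp ((real (k n) / real n) * (real n * ln (1 - \<mu> / real n))) = (1 - \<mu> / real n) ^ k n"
        using elim by (simp add: exp_of_nat_mult)
      \<comment> \<open>The powers of \<open>n\<close> balance: the factor \<open>n\<close> and the
        \<open>r\<close>-th power of \<open>\<mu> / n\<close> together leave \<open>n\<close> to the
        power \<open>1 - r\<close>, which is also what \<open>(k / n) powr (r - 1)\<close>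
        carries.\<close>
      have "real n * (\<mu> / real n) powr r = \<mu> powr r / real n powr (r - 1)"
        using elim mu by (simp add: powr_divide powr_diff)
      moreover have "(real (k n) / real n) powr (r - 1) = real (k n) powr (r - 1) / real n powr (r - 1)"
        by (simp add: powr_divide)
      ultimately have eq: "\<mu> powr r * (real (k n) / real n) powr (r - 1)
          = real n * (\<mu> / real n) powr r * real (k n) powr (r - 1)"
        by simp
      have kpos: "real (k n) powr (r - 1) > 0" using elim by simp
      have alg: "A / G * (g / (F * w)) * z * d = t * (g / (F * G) * u * d)"
        if "A * z = t * u * w" "w > 0" for A G g F w z d t u :: real
      proof -
        have "A / G * (g / (F * w)) * z * d = A * z / w * (g * d / (G * F))"
          by (simp add: mult_ac)
        also have "A * z / w = t * u"
          using that by simp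
        finally show ?thesis
          by (simp add: mult_ac)
      qed
      have "min q (\<mu> / real n) = \<mu> / real n" using elim by simp
      then show ?case
        unfolding e neg_binomial_mass_def by (simp only: alg[OF eq kpos])
    qed
  qed
  ultimately show ?thesis
    unfolding k_def by (simp add: Lim_transform_eventually)
qed

section \<open>Distribution functions under the weak law\<close>

lemma cdf_distr:
  assumes "Y \<in> borel_measurable M"
  shows "cdf (distr M borel Y) z = measure M {\<omega> \<in> space M. Y \<omega> \<le> z}"
proof -
  have "Y -` {..z} \<inter> space M = {\<omega> \<in> space M. Y \<omega> \<le> z}" by auto
  then show ?thesis
    using assms by (simp add: cdf_def measure_distr)
qed

text \<open>The distribution function of the point mass at \<open>a\<close> jumps only at
  \<open>a\<close>, so every other point is a continuity point, where weak convergence gives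
  convergence of the distribution functions.\<close>

lemma weak_conv_m_return_cdf:
  fixes Y :: "nat \<Rightarrow> 'a \<Rightarrow> real"
  assumes w: "weak_conv_m (\<lambda>n. distr M borel (Y n)) (return borel a)"
    and Y: "\<And>n. Y n \<in> borel_measurable M" and z: "z \<noteq> a"
  shows "(\<lambda>n. measure M {\<omega> \<in> space M. Y n \<omega> \<le> z}) \<longlonglongrightarrow> (if a < z then 1 else 0)"
proof -
  interpret R: real_distribution "return borel a"
    by (simp add: real_distribution_def real_distribution_axioms_def prob_space_return)
  have "isCont (cdf (return borel a)) z"
    using z by (subst R.isCont_cdf) (simp add: measure_return)
  then have "(\<lambda>n. cdf (distr M borel (Y n)) z) \<longlonglongrightarrow> cdf (return borel a) z"
    using w by (simp add: weak_conv_m_def weak_conv_def)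
  moreover have "cdf (return borel a) z = (if a < z then 1 else 0)"
    using z by (simp add: cdf_def measure_return indicator_def)
  moreover have "cdf (distr M borel (Y n)) z = measure M {\<omega> \<in> space M. Y n \<omega> \<le> z}" for n
    by (rule cdf_distr[OF Y])
  ultimately show ?thesis by simp
qed

text \<open>For use with \<open>c k\<close> the distribution function of the \<open>k\<close>-th
  average. The evaluation point moves with \<open>n\<close> but tends to \<open>y / x\<close>, which
  differs from \<open>a\<close>. Monotonicity compares it with a fixed \<open>z\<close> strictly
  between \<open>a\<close> and \<open>y / x\<close>, where the limit is known; the bounds 0 and 1
  close the sandwich.\<close>

lemma rescaled_cdf_limit:
  fixes c :: "nat \<Rightarrow> real \<Rightarrow> real"
  assumes c: "\<And>k z. 0 \<le> c k z" "\<And>k z. c k z \<le> 1" "\<And>k. mono (c k)"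
    and lim: "\<And>z. z \<noteq> a \<Longrightarrow> (\<lambda>k. c k z) \<longlonglongrightarrow> (if a < z then 1 else 0)"
    and x: "x > 0" and y: "a * x \<noteq> y"
  shows "(\<lambda>n. c (nat \<lfloor>real n * x\<rfloor>) (y * real n / real (nat \<lfloor>real n * x\<rfloor>)))
    \<longlonglongrightarrow> (if a * x \<le> y then 1 else 0)"
proof -
  define k where "k = (\<lambda>n::nat. nat \<lfloor>real n * x\<rfloor>)"
  have rk: "real (k n) = of_int \<lfloor>real n * x\<rfloor>" for n
    using x by (simp add: k_def)
  have "(\<lambda>n. real n / real (k n)) \<longlonglongrightarrow> inverse x"
    unfolding rk using x by real_asymp
  then have "(\<lambda>n. y * (real n / real (k n))) \<longlonglongrightarrow> y * inverse x"
    by (rule tendsto_mult_left)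
  then have yk: "(\<lambda>n. y * real n / real (k n)) \<longlonglongrightarrow> y / x"
    by (simp only: divide_inverse mult.assoc)
  have ktop: "filterlim k at_top sequentially"
    unfolding k_def using x by real_asymp
  have lim': "(\<lambda>n. c (k n) z) \<longlonglongrightarrow> (if a < z then 1 else 0)" if "z \<noteq> a" for z
    by (rule filterlim_compose[OF lim[OF that] ktop])
  show ?thesis
  proof (cases "a * x < y")
    case True
    then have "a < y / x" using x by (simp add: field_simps)
    then obtain z where z: "a < z" "z < y / x" using dense by blast
    have "\<forall>\<^sub>F n in sequentially. z < y * real n / real (k n)"
      using yk z(2) by (rule order_tendstoD)
    then have "\<forall>\<^sub>F n in sequentially. c (k n) z \<le> c (k n) (y * real n / real (k n))"
      by eventually_elim (auto intro: monoD[OF c(3)])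
    then have "(\<lambda>n. c (k n) (y * real n / real (k n))) \<longlonglongrightarrow> 1"
      by (rule tendsto_sandwich[OF _ _ _ tendsto_const]) (use lim'[of z] z c in auto)
    then show ?thesis using True by (simp add: k_def)
  next
    case False
    then have "y / x < a" using x y by (simp add: field_simps)
    then obtain z where z: "y / x < z" "z < a" using dense by blast
    have "\<forall>\<^sub>F n in sequentially. y * real n / real (k n) < z"
      using yk z(1) by (rule order_tendstoD)
    then have ev: "\<forall>\<^sub>F n in sequentially. c (k n) (y * real n / real (k n)) \<le> c (k n) z"
      by eventually_elim (auto intro: monoD[OF c(3)])
    have "(\<lambda>n. c (k n) (y * real n / real (k n))) \<longlonglongrightarrow> 0"
      by (rule tendsto_sandwich[OF _ ev tendsto_const]) (use lim'[of z] z c in auto)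
    then show ?thesis using False y by (simp add: k_def)
  qed
qed

section \<open>Conditioning on the random number of summands\<close>

text \<open>The event is split according to the value \<open>k\<close> of \<open>N\<close>, on which
  the random sum is the ordinary \<open>k\<close>-th partial sum; independence factors each
  piece.\<close>

lemma (in prob_space) prob_random_sum_le:
  fixes X :: "nat \<Rightarrow> 'a \<Rightarrow> real" and N :: "'a \<Rightarrow> nat"
  assumes X: "\<And>j. j \<ge> 1 \<Longrightarrow> X j \<in> borel_measurable M"
    and N[measurable]: "N \<in> M \<rightarrow>\<^sub>M count_space UNIV"
    and ind: "indep_rv M (count_space UNIV) N (Pi\<^sub>M {1..} (\<lambda>_. borel)) (\<lambda>\<omega>. \<lambda>j\<in>{1..}. X j \<omega>)"
  shows "prob {\<omega> \<in> space M. (\<Sum>j=1..N \<omega>. X j \<omega>) \<le> t}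
    = (\<Sum>k. prob {\<omega> \<in> space M. N \<omega> = k} * prob {\<omega> \<in> space M. (\<Sum>j=1..k. X j \<omega>) \<le> t})"
proof -
  define A where "A = (\<lambda>k. {\<omega> \<in> space M. N \<omega> = k})"
  define B where "B = (\<lambda>k. {\<omega> \<in> space M. (\<Sum>j=1..k. X j \<omega>) \<le> t})"
  have [measurable]: "(\<lambda>\<omega>. \<Sum>j=1..k. X j \<omega>) \<in> borel_measurable M" for k
    using X by (intro borel_measurable_sum) auto
  have [measurable]: "A k \<in> sets M" "B k \<in> sets M" for k
    unfolding A_def B_def by measurable
  have "prob (A k \<inter> B k) = prob (A k) * prob (B k)" for k
  proof (rule indep_setD)
    show "indep_set {N -` S \<inter> space M | S. S \<in> sets (count_space UNIV)}
        {(\<lambda>\<omega>. \<lambda>j\<in>{1..}. X j \<omega>) -` T \<inter> space M | T. T \<in> sets (Pi\<^sub>M {1..} (\<lambda>_. borel))}"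
      using ind by (simp add: indep_rv_def)
    show "A k \<in> {N -` S \<inter> space M | S. S \<in> sets (count_space UNIV)}"
      by (auto simp: A_def intro!: exI[of _ "{k}"])
    \<comment> \<open>\<open>T\<close> lifts the event on the partial sum to the sequence space. It
      depends only on coordinates \<open>1..k\<close>, so it is measurable there, and its preimage
      under the whole sequence is \<open>B k\<close>, as the independence hypothesis
      requires.\<close>
    define T where "T = {v \<in> space (Pi\<^sub>M {1..} (\<lambda>_. borel :: real measure)). (\<Sum>j=1..k. v j) \<le> t}"
    have "(\<lambda>v. \<Sum>j=1..k. v j) \<in> borel_measurable (Pi\<^sub>M {1..} (\<lambda>_. borel :: real measure))"
      by (intro borel_measurable_sum measurable_component_singleton) auto
    then have "T \<in> sets (Pi\<^sub>M {1..} (\<lambda>_. borel))"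
      unfolding T_def by measurable
    moreover have "B k = (\<lambda>\<omega>. \<lambda>j\<in>{1..}. X j \<omega>) -` T \<inter> space M"
      by (auto simp: B_def T_def space_PiM)
    ultimately show "B k \<in> {(\<lambda>\<omega>. \<lambda>j\<in>{1..}. X j \<omega>) -` T \<inter> space M | T. T \<in> sets (Pi\<^sub>M {1..} (\<lambda>_. borel))}"
      by blast
  qed
  moreover have "(\<lambda>k. prob (A k \<inter> B k)) sums prob (\<Union>k. A k \<inter> B k)"
    by (rule finite_measure_UNION) (auto simp: disjoint_family_on_def A_def)
  moreover have "(\<Union>k. A k \<inter> B k) = {\<omega> \<in> space M. (\<Sum>j=1..N \<omega>. X j \<omega>) \<le> t}"
    by (auto simp: A_def B_def)
  ultimately show ?thesis
    by (simp add: A_def B_def sums_iff)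
qed

lemma neg_binomial_mass_nonneg:
  assumes "0 < r" "0 < p" "p < 1"
  shows "0 \<le> neg_binomial_mass r p k"
  using assms by (simp add: neg_binomial_mass_def Gamma_real_pos less_imp_le add_pos_nonneg)

section \<open>Scaling of the gamma law\<close>

lemma gamma_density_scale:
  assumes "r > 0" "\<mu> > 0"
  shows "gamma_density r \<mu> (x / \<mu>) / \<mu> = gamma_density r 1 x"
proof (cases "x > 0")
  case True
  then show ?thesis
    using assms by (simp add: gamma_density_def powr_divide powr_diff field_simps)
next
  case False
  then show ?thesis
    using assms by (simp add: gamma_density_def divide_le_0_iff)
qed

text \<open>The variable \<open>\<mu> * G\<close> has the density of \<open>H\<close>, hence the
  same law; both laws are then pushed forward under multiplication by
  \<open>a / \<mu>\<close>.\<close>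

lemma distr_scaled_gamma_eq:
  assumes P: "prob_space P" and G: "distributed P lborel G (gamma_density r \<mu>)"
    and H: "distributed Q lborel H (gamma_density r 1)" and r: "r > 0" and mu: "\<mu> > 0"
  shows "distr P borel (\<lambda>x. a * G x) = distr Q borel (\<lambda>x. a / \<mu> * H x)"
proof -
  interpret P: prob_space P by fact
  have dens: "ennreal (gamma_density r \<mu> ((x - 0) / \<mu>)) / ennreal \<bar>\<mu>\<bar> = ennreal (gamma_density r 1 x)" for x
    using mu r by (simp add: divide_ennreal gamma_density_nonneg gamma_density_scale)
  have "distributed P lborel (\<lambda>x. 0 + \<mu> * G x) (gamma_density r 1)"
    using P.distributed_affine[OF G, of \<mu> 0] mu unfolding dens by simp
  then have G': "distributed P lborel (\<lambda>x. \<mu> * G x) (gamma_density r 1)"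
    by simp
  have meas: "(\<lambda>x. \<mu> * G x) \<in> borel_measurable P" "H \<in> borel_measurable Q"
    using G' H by (auto simp: distributed_def)
  have "distr P lborel (\<lambda>x. \<mu> * G x) = distr Q lborel H"
    using G' H by (simp add: distributed_def)
  \<comment> \<open>A pushforward depends on its target only through the measurable sets, and
    \<open>lborel\<close> and \<open>borel\<close> share these.\<close>
  then have eq: "distr P borel (\<lambda>x. \<mu> * G x) = distr Q borel H"
    by (metis distr_cong sets_lborel)
  have "distr P borel (\<lambda>x. a * G x) = distr (distr P borel (\<lambda>x. \<mu> * G x)) borel (\<lambda>x. a / \<mu> * x)"
    using mu meas by (subst distr_distr) (auto simp: comp_def)
  also have "\<dots> = distr Q borel (\<lambda>x. a / \<mu> * H x)"
    unfolding eq using meas by (subst distr_distr) (auto simp: comp_def)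
  finally show ?thesis .
qed

section \<open>Convergence of the distribution functions of the normalised random sums\<close>

theorem theorem1:
  fixes M :: "'a measure"
    and X :: "nat \<Rightarrow> 'a \<Rightarrow> real"
    and N :: "nat \<Rightarrow> 'a \<Rightarrow> nat"
    and P :: "'b measure" and G\<^sub>\<mu> :: "'b \<Rightarrow> real"
    and Q :: "'c measure" and G\<^sub>1 :: "'c \<Rightarrow> real"
    and a r q \<mu> :: real
  assumes "prob_space M"
    and "\<And>j. j \<ge> 1 \<Longrightarrow> X j \<in> borel_measurable M"
    and "a > 0"
    and "weak_conv_m (\<lambda>n. distr M borel (\<lambda>\<omega>. (\<Sum>j=1..n. X j \<omega>) / real n)) (return borel a)"
    and "r > 0" and "0 < q" and "q < 1" and "\<mu> > 0"
    and "\<And>n. n \<ge> 1 \<Longrightarrow> N n \<in> M \<rightarrow>\<^sub>M count_space UNIV"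
    and "\<And>n k. n \<ge> 1 \<Longrightarrow>
      measure M {\<omega> \<in> space M. N n \<omega> = k} = neg_binomial_mass r (min q (\<mu> / real n)) k"
    and "\<And>n. n \<ge> 1 \<Longrightarrow>
      indep_rv M (count_space UNIV) (N n)
        (Pi\<^sub>M {1..} (\<lambda>_. borel)) (\<lambda>\<omega>. \<lambda>j\<in>{1..}. X j \<omega>)"
    and "prob_space P" and "distributed P lborel G\<^sub>\<mu> (gamma_density r \<mu>)"
    and "prob_space Q" and "distributed Q lborel G\<^sub>1 (gamma_density r 1)"
  shows "weak_conv_m (\<lambda>n. distr M borel (\<lambda>\<omega>. (\<Sum>j=1..N n \<omega>. X j \<omega>) / real n))
           (distr P borel (\<lambda>x. a * G\<^sub>\<mu> x)) \<and>
         distr P borel (\<lambda>x. a * G\<^sub>\<mu> x) = distr Q borel (\<lambda>x. a / \<mu> * G\<^sub>1 x)"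
proof (intro conjI)
  interpret prob_space M by fact
  interpret P: prob_space P by fact
  note X = assms(2) and N = assms(9) and mass = assms(10) and ind = assms(11) and G = assms(13)
  have pos: "0 < r" "0 < \<mu>" by fact+
  have G_meas [measurable]: "G\<^sub>\<mu> \<in> borel_measurable P"
    using G by (simp add: distributed_def)
  have S_meas [measurable]: "(\<lambda>\<omega>. \<Sum>j=1..k. X j \<omega>) \<in> borel_measurable M" for k
    using X by (intro borel_measurable_sum) auto
  define m where "m = (\<lambda>n. neg_binomial_mass r (min q (\<mu> / real n)))"
  define c where "c = (\<lambda>k z. prob {\<omega> \<in> space M. (\<Sum>j=1..k. X j \<omega>) / real k \<le> z})"
  have c_lim: "(\<lambda>k. c k z) \<longlonglongrightarrow> (if a < z then 1 else 0)" if "z \<noteq> a" for z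
    unfolding c_def
    by (rule weak_conv_m_return_cdf[OF assms(4) borel_measurable_divide[OF S_meas borel_measurable_const] that])
  have c_mono: "mono (c k)" for k
    unfolding c_def by (intro monoI finite_measure_mono) (auto simp del: One_nat_def)
  have p01: "0 < min q (\<mu> / real n)" "min q (\<mu> / real n) < 1" if "n \<ge> 1" for n
    using assms(6-8) that by auto
  show "weak_conv_m (\<lambda>n. distr M borel (\<lambda>\<omega>. (\<Sum>j=1..N n \<omega>. X j \<omega>) / real n))
      (distr P borel (\<lambda>x. a * G\<^sub>\<mu> x))"
    unfolding weak_conv_m_def weak_conv_def
  proof (intro allI impI)
    fix y
    define g where "g = (\<lambda>n k. prob {\<omega> \<in> space M. (\<Sum>j=1..k. X j \<omega>) \<le> y * real n})"
    \<comment> \<open>The pointwise limit of \<open>g n\<close> along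
      \<open>k = nat \<lfloor>real n * x\<rfloor>\<close> for almost every \<open>x > 0\<close>: the
      partial sum is then close to \<open>a * x * n\<close>, to be compared with
      \<open>y * n\<close>.\<close>
    define h where "h = (\<lambda>x::real. if a * x \<le> y then 1 else 0 :: real)"
    have [measurable]: "h \<in> borel_measurable borel" by (simp add: h_def)
    have "(\<lambda>n. \<Sum>k. m n k * g n k) \<longlonglongrightarrow> (\<integral>x. gamma_density r \<mu> x * h x \<partial>lborel)"
    proof (rule mixture_limit)
      show "0 \<le> m n k" if "n \<ge> 1" for n k
        using p01[OF that] pos by (simp add: m_def neg_binomial_mass_nonneg)
      show "m n sums 1" if "n \<ge> 1" for n
        using p01[OF that] pos by (simp add: m_def neg_binomial_mass_sums_1)
      show "gamma_density r \<mu> x = 0" if "x < 0" for x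
        using that by (simp add: gamma_density_def)
      show "AE x in lborel. 0 < x \<longrightarrow>
          (\<lambda>n. real n * m n (nat \<lfloor>real n * x\<rfloor>)) \<longlonglongrightarrow> gamma_density r \<mu> x"
        unfolding m_def using assms(5-8) by (auto intro: neg_binomial_local_limit)
      show "AE x in lborel. 0 < x \<longrightarrow> (\<lambda>n. g n (nat \<lfloor>real n * x\<rfloor>)) \<longlonglongrightarrow> h x"
        \<comment> \<open>At \<open>x = y / a\<close> the threshold sits at the jump of the
          degenerate limit law; this single point is discarded.\<close>
        using AE_lborel_singleton[of "y / a"]
      proof eventually_elim
        case (elim x)
        show ?case
        proof
          assume x: "0 < x"
          have "(\<lambda>n. c (nat \<lfloor>real n * x\<rfloor>) (y * real n / real (nat \<lfloor>real n * x\<rfloor>))) \<longlonglongrightarrow> h x"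
            unfolding h_def
            by (rule rescaled_cdf_limit)
              (use c_mono c_lim x elim \<open>a > 0\<close> in \<open>auto simp: c_def field_simps\<close>)
          \<comment> \<open>Dividing the partial sum and the threshold by \<open>k\<close> preserves
            the event only for \<open>k > 0\<close>, since division by 0 yields 0; this holds for
            large \<open>n\<close>.\<close>
          moreover have "\<forall>\<^sub>F n in sequentially. 0 < nat \<lfloor>real n * x\<rfloor>"
            using x by real_asymp
          then have "\<forall>\<^sub>F n in sequentially.
              c (nat \<lfloor>real n * x\<rfloor>) (y * real n / real (nat \<lfloor>real n * x\<rfloor>)) = g n (nat \<lfloor>real n * x\<rfloor>)"
            by eventually_elim (simp add: c_def g_def divide_le_cancel)
          ultimately show "(\<lambda>n. g n (nat \<lfloor>real n * x\<rfloor>)) \<longlonglongrightarrow> h x"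
            by (rule Lim_transform_eventually)
        qed
      qed
    qed (use pos in \<open>auto simp: g_def gamma_density_nonneg prob_space_gamma_density\<close>)
    moreover have "(\<integral>x. gamma_density r \<mu> x * h x \<partial>lborel) = cdf (distr P borel (\<lambda>x. a * G\<^sub>\<mu> x)) y"
    proof -
      \<comment> \<open>The limit integral is the expectation of \<open>h\<close> at the gamma
        variable, that is, the probability that \<open>a * G\<^sub>\<mu>\<close> is at most
        \<open>y\<close>.\<close>
      have "(\<integral>x. gamma_density r \<mu> x * h x \<partial>lborel) = (\<integral>x. h (G\<^sub>\<mu> x) \<partial>P)"
        using G pos by (intro distributed_integral) (auto simp: gamma_density_nonneg)
      also have "\<dots> = (\<integral>x. indicator {x \<in> space P. a * G\<^sub>\<mu> x \<le> y} x \<partial>P)"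
        by (intro Bochner_Integration.integral_cong) (auto simp: h_def)
      also have "\<dots> = measure P {x \<in> space P. a * G\<^sub>\<mu> x \<le> y}"
        by (simp add: Int_absorb2)
      finally show ?thesis
        by (simp add: cdf_distr)
    qed
    moreover have "\<forall>\<^sub>F n in sequentially. (\<Sum>k. m n k * g n k)
        = cdf (distr M borel (\<lambda>\<omega>. (\<Sum>j=1..N n \<omega>. X j \<omega>) / real n)) y"
      using eventually_ge_at_top[of 1]
    proof eventually_elim
      case (elim n)
      note [measurable] = N[OF elim]
      \<comment> \<open>The random sum is measurable because \<open>N n\<close> has countably many
        values and each partial sum is measurable.\<close>
      have [measurable]: "(\<lambda>\<omega>. \<Sum>j=1..N n \<omega>. X j \<omega>) \<in> borel_measurable M"
        by (rule measurable_compose_countable) measurable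
      have "prob {\<omega> \<in> space M. (\<Sum>j=1..N n \<omega>. X j \<omega>) \<le> y * real n}
          = (\<Sum>k. prob {\<omega> \<in> space M. N n \<omega> = k} * g n k)"
        unfolding g_def using X by (intro prob_random_sum_le N[OF elim] ind[OF elim])
      moreover have "{\<omega> \<in> space M. (\<Sum>j=1..N n \<omega>. X j \<omega>) \<le> y * real n}
          = {\<omega> \<in> space M. (\<Sum>j=1..N n \<omega>. X j \<omega>) / real n \<le> y}"
        using elim by (simp add: pos_divide_le_eq)
      moreover have "(\<lambda>\<omega>. (\<Sum>j=1..N n \<omega>. X j \<omega>) / real n) \<in> borel_measurable M"
        by measurable
      ultimately show ?case
        by (simp only: m_def mass[OF elim] cdf_distr)
    qed
    ultimately show "(\<lambda>n. cdf (distr M borel (\<lambda>\<omega>. (\<Sum>j=1..N n \<omega>. X j \<omega>) / real n)) y)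
        \<longlonglongrightarrow> cdf (distr P borel (\<lambda>x. a * G\<^sub>\<mu> x)) y"
      by (simp add: Lim_transform_eventually)
  qed
  show "distr P borel (\<lambda>x. a * G\<^sub>\<mu> x) = distr Q borel (\<lambda>x. a / \<mu> * G\<^sub>1 x)"
    by (rule distr_scaled_gamma_eq) fact+
qed

end
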